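(* Let $n$ be a positive integer. For any kernel $u:\{-n,\dots,n\}\to\mathbb{R}$ normalized by $\sum_{\ell=-n}^{n}u(\ell)=1$, $$\sup_{0\neq f\in\ell^2(\mathbb{Z})}\frac{\|\Delta(u\ast f)\|_{\ell^2(\mathbb{Z})}}{\|f\|_{\ell^2(\mathbb{Z})}}\;\geq\;\frac{4}{n+1}\cdot\frac{\sin\left(\frac{\pi}{2n+2}\right)}{1+\cos\left(\frac{\pi}{2n+2}\right)},$$ with equality if and only if $u=u_n$, where $u_n:\{-n,\dots,n\}\to\mathbb{R}$ is the symmetric kernel ($u_n(-k)=u_n(k)$) given for $0\le k\le n$ by $$u_n(k)=\frac{1}{\pi}\int_{-1}^{1}S_n(x)\,T_k(x)\,\frac{dx}{\sqrt{1-x^2}},$$ with $$S_n(x)=\frac{1}{x-1}\cdot\frac{2\sin\left(\frac{\pi}{2n+2}\right)}{(n+1)\left(1+\cos\left(\frac{\pi}{2n+2}\right)\right)}\cdot T_{n+1}\!\left(\frac{1+\cos\left(\frac{\pi}{2n+2}\right)}{2}(x+1)-1\right).$$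
   Context: Functions $f$ range over real-valued square-summable $f:\mathbb{Z}\to\mathbb{R}$. For $u:\{-n,\dots,n\}\to\mathbb{R}$, the convolution is $(u\ast f)(k)=\sum_{\ell=-n}^{n}u(\ell)f(k-\ell)$ for $k\in\mathbb{Z}$. The discrete Laplacian is $(\Delta f)(k)=f(k+2)-2f(k+1)+f(k)$. The Chebyshev polynomials $T_k$ are defined by $T_0(x)=1$, $T_1(x)=x$, $T_{k+1}(x)=2xT_k(x)-T_{k-1}(x)$. The expression $S_n(x)$ is a polynomial in $x$ (the factor $T_{n+1}(\cdot)$ vanishes at $x=1$, so the division by $x-1$ is exact), and its value at $x=1$ is that of this polynomial. *)

theory Defs
  imports
    "HOL-Analysis.Analysis"
    "HOL-Computational_Algebra.Polynomial"
begin

definition ell2 :: "(int \<Rightarrow> real) \<Rightarrow> bool" where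
  "ell2 f \<longleftrightarrow> (\<lambda>k. (f k)\<^sup>2) summable_on UNIV"

definition ell2_norm :: "(int \<Rightarrow> real) \<Rightarrow> real" where
  "ell2_norm f = sqrt (\<Sum>\<^sub>\<infinity>k\<in>UNIV. (f k)\<^sup>2)"

text \<open>A kernel on \<open>{-n..n}\<close> is represented by a total function on the integers whose values
  outside \<open>{-n..n}\<close> are never used.\<close>

definition convolve :: "nat \<Rightarrow> (int \<Rightarrow> real) \<Rightarrow> (int \<Rightarrow> real) \<Rightarrow> int \<Rightarrow> real" where
  "convolve n u f k = (\<Sum>l = - int n..int n. u l * f (k - l))"

definition laplacian :: "(int \<Rightarrow> real) \<Rightarrow> int \<Rightarrow> real" where
  "laplacian f k = f (k + 2) - 2 * f (k + 1) + f k"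

fun Cheb :: "nat \<Rightarrow> real poly" where
  "Cheb 0 = 1"
| "Cheb (Suc 0) = [:0, 1:]"
| "Cheb (Suc (Suc k)) = 2 * [:0, 1:] * Cheb (Suc k) - Cheb k"

text \<open>The inner affine map \<open>a (x + 1) - 1\<close>, with \<open>a = (1 + cos (pi / (2 n + 2))) / 2\<close>, is the
  polynomial \<open>[:a - 1, a:]\<close>; the polynomial division by \<open>x - 1\<close> is exact, see below.\<close>

definition S_num :: "nat \<Rightarrow> real poly" where
  "S_num n =
     (let t = pi / (2 * real n + 2); a = (1 + cos t) / 2
      in smult (2 * sin t / ((real n + 1) * (1 + cos t))) (pcompose (Cheb (n + 1)) [:a - 1, a:]))"

definition S_poly :: "nat \<Rightarrow> real poly" where
  "S_poly n = S_num n div [:-1, 1:]"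

definition opt_kernel :: "nat \<Rightarrow> int \<Rightarrow> real" where
  "opt_kernel n k =
     1 / pi * integral {-1..1}
       (\<lambda>x. poly (S_poly n) x * poly (Cheb (nat \<bar>k\<bar>)) x / sqrt (1 - x\<^sup>2))"

lemma poly_Cheb_cos: "poly (Cheb k) (cos t) = cos (real k * t)"
proof (induction k rule: Cheb.induct)
  case (3 k)
  have "cos (real (Suc (Suc k)) * t) + cos (real k * t) = 2 * cos t * cos (real (Suc k) * t)"
    using cos_add[of "real (Suc k) * t" t] cos_diff[of "real (Suc k) * t" t]
    by (simp add: algebra_simps)
  then show ?case using 3 by (simp add: algebra_simps)
qed auto

lemma poly_S_num_1: "poly (S_num n) 1 = 0"
proof -
  define t where "t = pi / (2 * real n + 2)"
  have "real (n + 1) * t = pi / 2"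
    by (simp add: t_def divide_simps)
  then have "poly (Cheb (n + 1)) (cos t) = 0"
    by (simp only: poly_Cheb_cos cos_pi_half)
  moreover have "poly [:(1 + cos t) / 2 - 1, (1 + cos t) / 2:] 1 = cos t"
    by (simp add: field_simps)
  ultimately show ?thesis
    by (simp only: S_num_def Let_def t_def[symmetric] poly_smult poly_pcompose mult_zero_right)
qed

lemma S_poly_exact: "[:-1, 1:] * S_poly n = S_num n"
  using poly_S_num_1[of n] by (simp add: S_poly_def poly_eq_0_iff_dvd del: mult_pCons_left)

lemma poly_S_poly:
  assumes "x \<noteq> 1"
  shows "poly (S_poly n) x =
    1 / (x - 1)
    * (2 * sin (pi / (2 * real n + 2)) / ((real n + 1) * (1 + cos (pi / (2 * real n + 2)))))
    * poly (Cheb (n + 1)) ((1 + cos (pi / (2 * real n + 2))) / 2 * (x + 1) - 1)"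
proof -
  have "(x - 1) * poly (S_poly n) x = poly (S_num n) x"
    by (subst S_poly_exact[symmetric]) (simp add: algebra_simps)
  also have "\<dots> = 2 * sin (pi / (2 * real n + 2)) / ((real n + 1) * (1 + cos (pi / (2 * real n + 2))))
    * poly (Cheb (n + 1)) ((1 + cos (pi / (2 * real n + 2))) / 2 * (x + 1) - 1)"
  proof -
    have "poly [:a - 1, a:] x = a * (x + 1) - 1" for a :: real
      by (simp add: algebra_simps)
    then show ?thesis
      by (simp only: S_num_def Let_def poly_smult poly_pcompose)
  qed
  finally show ?thesis
    using assms by (metis (no_types) divide_inverse eq_iff_diff_eq_0 inverse_eq_divide mult.assoc
      mult.commute nonzero_mult_div_cancel_left)
qed

end

theory Submission imports Defs begin

text \<open>The map \<open>f \<mapsto> \<Delta>(u \<ast> f)\<close> multiplies the Fourier transform by \<open>(exp(-it) - 1)\<^sup>2 K(t)\<close>, with \<open>K\<close> the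
  trigonometric polynomial of the kernel \<open>u\<close>, so its norm is the supremum of \<open>(2 - 2 cos t) \<bar>K(t)\<bar>\<close>.
  The real part of \<open>K\<close> is \<open>p(cos t)\<close> for a polynomial \<open>p\<close> of degree at most \<open>n\<close> with \<open>p(1) = 1\<close>, and
  equioscillation of \<open>(x - 1) S\<^sub>n(x)\<close> shows that \<open>p = S\<^sub>n\<close> is the unique minimizer of the maximum of
  \<open>2 (1 - x) \<bar>p(x)\<bar>\<close> over \<open>[-1, 1]\<close>. For an optimal kernel the imaginary part of \<open>K\<close> vanishes where
  that maximum is attained, which is at enough points to make \<open>K\<close> real.\<close>

subsection \<open>Chebyshev polynomials\<close>

lemma Cheb_arccos: "\<bar>x\<bar> \<le> 1 \<Longrightarrow> poly (Cheb m) x = cos (real m * arccos x)"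
  using poly_Cheb_cos[of m "arccos x"] by (simp add: cos_arccos_abs)

lemma poly_Cheb_1: "poly (Cheb m) 1 = 1"
  using poly_Cheb_cos[of m 0] by simp

lemma degree_Cheb_le: "degree (Cheb k) \<le> k"
proof (induction k rule: Cheb.induct)
  case (3 k)
  have "degree (2 * [:0, 1:] * Cheb (Suc k)) \<le> degree (2 * [:0, 1:] :: real poly) + degree (Cheb (Suc k))"
    by (rule degree_mult_le)
  also have "degree (2 * [:0, 1:] :: real poly) \<le> 1"
    using degree_mult_le[of 2 "[:0, 1:] :: real poly"] by simp
  finally show ?case
    using 3 by (auto intro!: degree_diff_le)
qed auto

lemma coeff_Cheb_pos: "coeff (Cheb k) k > 0"
proof (induction k rule: Cheb.induct)
  case (3 k)
  have "coeff (Cheb k) (Suc (Suc k)) = 0"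
    using degree_Cheb_le[of k] by (intro coeff_eq_0) simp
  moreover have "Cheb (Suc (Suc k)) = pCons 0 (smult 2 (Cheb (Suc k))) - Cheb k"
    by (simp add: numeral_poly)
  ultimately show ?case using 3 by simp
qed auto

lemma Cheb_expansion:
  assumes "degree p \<le> n"
  shows "\<exists>a. p = (\<Sum>m\<le>n. smult (a m) (Cheb m))"
  using assms
proof (induction n arbitrary: p)
  case 0
  then obtain c where "p = [:c:]" using degree_eq_zeroE by blast
  then show ?case by (intro exI[of _ "\<lambda>_. c"]) simp
next
  case (Suc n)
  \<comment> \<open>This choice cancels the coefficient of degree \<open>Suc n\<close>, so the
    induction hypothesis covers \<open>q\<close>.\<close>
  define c where "c = coeff p (Suc n) / coeff (Cheb (Suc n)) (Suc n)"
  define q where "q = p - smult c (Cheb (Suc n))"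
  have "coeff q i = 0" if "i > n" for i
  proof (cases "i = Suc n")
    case True
    then show ?thesis using coeff_Cheb_pos[of "Suc n"] by (simp add: q_def c_def)
  next
    case False
    with that have "degree p < i" "degree (Cheb (Suc n)) < i"
      using Suc.prems degree_Cheb_le[of "Suc n"] by auto
    then show ?thesis by (simp add: q_def coeff_eq_0)
  qed
  then have "degree q \<le> n" by (intro degree_le) auto
  then obtain a where a: "q = (\<Sum>m\<le>n. smult (a m) (Cheb m))" using Suc.IH by blast
  have "p = (\<Sum>m\<le>Suc n. smult ((a(Suc n := c)) m) (Cheb m))"
    using a by (simp add: q_def algebra_simps)
  then show ?case by blast
qed

section \<open>Orthogonality and Chebyshev coefficients\<close>

lemma has_integral_Cheb_weight:
  "((\<lambda>x. poly (Cheb m) x / sqrt (1 - x\<^sup>2)) has_integral (if m = 0 then pi else 0)) {-1..1}"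
proof (cases "m = 0")
  case True
  \<comment> \<open>The weight is singular at both ends, so the antiderivative is differentiated in
    the interior only.\<close>
  have "((\<lambda>x. inverse (sqrt (1 - x\<^sup>2))) has_integral (arcsin 1 - arcsin (-1))) {-1..1}"
    by (rule fundamental_theorem_of_calculus_interior)
      (auto intro!: continuous_on_arcsin' DERIV_arcsin simp flip: has_real_derivative_iff_has_vector_derivative)
  then show ?thesis using True by (simp add: inverse_eq_divide arcsin_minus)
next
  case False
  \<comment> \<open>Found by substituting \<open>x = cos t\<close>, which turns the integrand into
    \<open>cos (m t)\<close>.\<close>
  define F where "F x = - sin (real m * arccos x) / real m" for x
  have "((\<lambda>x. poly (Cheb m) x / sqrt (1 - x\<^sup>2)) has_integral (F 1 - F (-1))) {-1..1}"
  proof (rule fundamental_theorem_of_calculus_interior)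
    show "continuous_on {-1..1} F"
      unfolding F_def using False by (auto intro!: continuous_intros)
    fix x :: real assume x: "x \<in> {-1<..<1}"
    then have "(F has_real_derivative poly (Cheb m) x / sqrt (1 - x\<^sup>2)) (at x)"
      unfolding F_def using False
      by (auto intro!: derivative_eq_intros DERIV_arccos simp: Cheb_arccos abs_le_iff field_simps)
    then show "(F has_vector_derivative poly (Cheb m) x / sqrt (1 - x\<^sup>2)) (at x)"
      by (simp add: has_real_derivative_iff_has_vector_derivative)
  qed auto
  moreover have "F 1 = 0" "F (-1) = 0"
    by (auto simp: F_def sin_npi)
  ultimately show ?thesis using False by simp
qed

text \<open>For \<open>j \<le> k\<close> the identity \<open>2 T_j T_k = T_(k+j) + T_(k-j)\<close>
  reduces this to integrals of a single Chebyshev polynomial.\<close>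

lemma has_integral_Cheb_prod:
  "((\<lambda>x. poly (Cheb j) x * poly (Cheb k) x / sqrt (1 - x\<^sup>2)) has_integral
     (if j = k then if k = 0 then pi else pi / 2 else 0)) {-1..1}"
proof (induction j k rule: linorder_wlog)
  case (le j k)
  have "((\<lambda>x. (poly (Cheb (k + j)) x / sqrt (1 - x\<^sup>2) + poly (Cheb (k - j)) x / sqrt (1 - x\<^sup>2)) / 2)
      has_integral ((if k + j = 0 then pi else 0) + (if k - j = 0 then pi else 0)) / 2) {-1..1}"
    by (intro has_integral_divide has_integral_add has_integral_Cheb_weight)
  moreover have "(poly (Cheb (k + j)) x / sqrt (1 - x\<^sup>2) + poly (Cheb (k - j)) x / sqrt (1 - x\<^sup>2)) / 2
      = poly (Cheb j) x * poly (Cheb k) x / sqrt (1 - x\<^sup>2)" if "x \<in> {-1..1}" for x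
  proof -
    have "poly (Cheb (k + j)) x + poly (Cheb (k - j)) x = 2 * (poly (Cheb j) x * poly (Cheb k) x)"
      using that le cos_add[of "real k * arccos x" "real j * arccos x"]
        cos_diff[of "real k * arccos x" "real j * arccos x"]
      by (simp add: Cheb_arccos abs_le_iff algebra_simps of_nat_diff)
    then show ?thesis by (simp flip: add_divide_distrib)
  qed
  ultimately have "((\<lambda>x. poly (Cheb j) x * poly (Cheb k) x / sqrt (1 - x\<^sup>2)) has_integral
      ((if k + j = 0 then pi else 0) + (if k - j = 0 then pi else 0)) / 2) {-1..1}"
    by (rule has_integral_eq[rotated])
  then show ?case using le by (auto split: if_splits)
next
  case (sym j k)
  then show ?case by (cases "j = k") (simp_all add: mult.commute)
qed

text \<open>For \<open>p\<close> the sum of \<open>a_m T_m\<close> this is \<open>a_0\<close> at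
  \<open>k = 0\<close> but \<open>a_k / 2\<close> for \<open>k > 0\<close>: a coefficient is split
  evenly between the kernel places \<open>k\<close> and \<open>-k\<close>.\<close>

definition cheb_coeff :: "nat \<Rightarrow> real poly \<Rightarrow> real" where
  "cheb_coeff k p = 1 / pi * integral {-1..1} (\<lambda>x. poly p x * poly (Cheb k) x / sqrt (1 - x\<^sup>2))"

lemma opt_kernel_eq: "opt_kernel n k = cheb_coeff (nat \<bar>k\<bar>) (S_poly n)"
  by (simp add: opt_kernel_def cheb_coeff_def)

text \<open>The map \<open>m\<close> may repeat degrees, so the sum can run over kernel places
  \<open>l\<close> with degree \<open>nat \<bar>l\<bar>\<close>.\<close>

lemma cheb_coeff_sum:
  assumes "finite A"
  shows "cheb_coeff k (\<Sum>i\<in>A. smult (a i) (Cheb (m i)))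
    = (\<Sum>i\<in>A. if m i = k then (if k = 0 then a i else a i / 2) else 0)"
proof -
  have "((\<lambda>x. \<Sum>i\<in>A. a i * (poly (Cheb (m i)) x * poly (Cheb k) x / sqrt (1 - x\<^sup>2))) has_integral
     (\<Sum>i\<in>A. a i * (if m i = k then if k = 0 then pi else pi / 2 else 0))) {-1..1}"
    by (intro has_integral_sum assms has_integral_mult_right has_integral_Cheb_prod)
  also have "(\<lambda>x. \<Sum>i\<in>A. a i * (poly (Cheb (m i)) x * poly (Cheb k) x / sqrt (1 - x\<^sup>2)))
     = (\<lambda>x. poly (\<Sum>i\<in>A. smult (a i) (Cheb (m i))) x * poly (Cheb k) x / sqrt (1 - x\<^sup>2))"
    by (simp add: poly_sum sum_distrib_right sum_divide_distrib mult.assoc)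
  finally show ?thesis
    unfolding cheb_coeff_def by (auto simp: integral_unique sum_distrib_left intro!: sum.cong)
qed

text \<open>Differentiate \<open>T_m (cos t) = cos (m t)\<close> in two ways.\<close>

lemma poly_pderiv_Cheb_cos: "poly (pderiv (Cheb m)) (cos t) * sin t = real m * sin (real m * t)"
proof -
  have "((\<lambda>t. poly (Cheb m) (cos t)) has_real_derivative poly (pderiv (Cheb m)) (cos t) * (- sin t)) (at t)"
    by (rule DERIV_chain2[OF poly_DERIV]) (auto intro!: derivative_eq_intros)
  moreover have "((\<lambda>t. poly (Cheb m) (cos t)) has_real_derivative - (real m * sin (real m * t))) (at t)"
    unfolding poly_Cheb_cos by (auto intro!: derivative_eq_intros)
  ultimately show ?thesis using DERIV_unique by fastforce
qed

text \<open>The coefficient of \<open>X ^ m\<close> in the Lagrange interpolant \<open>Q = e\<close> is \<open>0\<close>, but all its summands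
  \<open>e(x\<^sub>j) / w\<^sub>j\<close> are nonnegative, so they vanish.\<close>

lemma alternating_imp_zero:
  fixes e :: "real poly" and x :: "nat \<Rightarrow> real"
  assumes dec: "\<And>i j. i < j \<Longrightarrow> j \<le> m \<Longrightarrow> x j < x i"
    and deg: "degree e < m"
    and alt: "\<And>j. j \<le> m \<Longrightarrow> 0 \<le> (-1) ^ j * poly e (x j)"
  shows "e = 0"
proof -
  define w where "w j = (\<Prod>i\<in>{..m} - {j}. x j - x i)" for j
  define L where "L j = (\<Prod>i\<in>{..m} - {j}. [:- x i, 1:])" for j
  define Q where "Q = (\<Sum>j\<le>m. smult (poly e (x j) / w j) (L j))"
  \<comment> \<open>The nodes decrease, so the \<open>j\<close> factors with \<open>i < j\<close>
    are negative and the others positive.\<close>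
  have w_pos: "(-1) ^ j * w j > 0" if "j \<le> m" for j
  proof -
    have "{..m} - {j} = {..<j} \<union> {j<..m}" using that by auto
    then have "w j = (\<Prod>i\<in>{..<j} \<union> {j<..m}. x j - x i)" by (simp only: w_def)
    also have "\<dots> = (\<Prod>i<j. x j - x i) * (\<Prod>i\<in>{j<..m}. x j - x i)"
      by (rule prod.union_disjoint) auto
    finally have "w j = (\<Prod>i<j. x j - x i) * (\<Prod>i\<in>{j<..m}. x j - x i)" .
    moreover have "(-1) ^ j * (\<Prod>i<j. x j - x i) = (\<Prod>i<j. x i - x j)"
    proof -
      have "(\<Prod>i<j. x i - x j) = (\<Prod>i<j. (-1) * (x j - x i))" by simp
      then show ?thesis by (simp only: prod.distrib prod_constant card_lessThan)
    qed
    moreover have "(\<Prod>i<j. x i - x j) > 0" using dec that by (intro prod_pos) auto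
    moreover have "(\<Prod>i\<in>{j<..m}. x j - x i) > 0" using dec by (intro prod_pos) auto
    ultimately show ?thesis by (simp flip: mult.assoc)
  qed
  then have w_nz: "w j \<noteq> 0" if "j \<le> m" for j using that by fastforce
  have inj: "inj_on x {..m}"
    by (rule linorder_inj_onI) (use dec in fastforce)+
  have degL: "degree (L j) = m" and coeffL: "coeff (L j) m = 1" if "j \<le> m" for j
  proof -
    show d: "degree (L j) = m"
      unfolding L_def using that by (subst degree_prod_eq_sum_degree) auto
    have "lead_coeff (L j) = 1" by (simp add: L_def lead_coeff_prod)
    then show "coeff (L j) m = 1" by (simp add: d)
  qed
  have LQ: "poly Q (x k) = poly e (x k)" if "k \<le> m" for k
  proof -
    have "poly (L j) (x k) = (if j = k then w k else 0)" if "j \<le> m" for j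
      using \<open>k \<le> m\<close> by (auto simp: L_def w_def poly_prod intro!: prod_zero)
    then have "poly Q (x k) = (\<Sum>j\<le>m. if j = k then poly e (x k) else 0)"
      unfolding Q_def poly_sum using w_nz that by (intro sum.cong) auto
    then show ?thesis using that by simp
  qed
  have "degree Q \<le> m" unfolding Q_def
    by (intro degree_sum_le) (auto intro: order.trans[OF degree_smult_le] simp: degL)
  then have "Q = e"
    using LQ deg by (intro poly_eqI_degree[of "x ` {..m}"]) (auto simp: card_image inj)
  then have "coeff Q m = 0" using deg by (simp add: coeff_eq_0)
  then have "(\<Sum>j\<le>m. poly e (x j) / w j) = 0"
    by (simp add: Q_def coeff_sum coeffL)
  moreover have nn: "poly e (x j) / w j \<ge> 0" if "j \<le> m" for j
  proof -
    have "poly e (x j) / w j = ((-1) ^ j * poly e (x j)) / ((-1) ^ j * w j)" by simp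
    then show ?thesis using w_pos[OF that] alt[OF that] by (metis divide_nonneg_pos)
  qed
  ultimately have "poly e (x j) / w j = 0" if "j \<le> m" for j
    using that sum_nonneg_eq_0_iff[of "{..m}" "\<lambda>j. poly e (x j) / w j"] by auto
  then have "poly e (x j) = 0" if "j \<le> m" for j using that w_nz by auto
  then show ?thesis
    using deg by (intro poly_eqI_degree[of "x ` {..m}"]) (auto simp: card_image inj)
qed

subsection \<open>The norm of a convolution operator\<close>

lemma integral_cos_int:
  "((\<lambda>t. cos (of_int m * t)) has_integral (if m = 0 then 2 * pi else 0)) {-pi..pi}"
proof (cases "m = 0")
  case True
  then show ?thesis using has_integral_const_real[of "1::real" "-pi" pi] by simp
next
  case False
  have "((\<lambda>t. cos (of_int m * t)) has_integral
      (sin (of_int m * pi) / of_int m - sin (of_int m * (-pi)) / of_int m)) {-pi..pi}"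
    by (rule fundamental_theorem_of_calculus)
      (use False in \<open>auto intro!: derivative_eq_intros simp flip: has_real_derivative_iff_has_vector_derivative\<close>)
  moreover have "sin (of_int m * pi) = 0" by (metis mult.commute sin_zero_iff_int2)
  ultimately show ?thesis using False by simp
qed

text \<open>Expanding the square gives terms \<open>c j * c k * cos ((j - k) * t)\<close>;
  integration over a full period keeps the diagonal.\<close>

lemma parseval_finite:
  fixes c :: "int \<Rightarrow> real"
  assumes "finite A"
  shows "((\<lambda>t. (cmod (\<Sum>k\<in>A. of_real (c k) * cis (of_int k * t)))\<^sup>2) has_integral
    2 * pi * (\<Sum>k\<in>A. (c k)\<^sup>2)) {-pi..pi}"
proof -
  have eq: "(cmod (\<Sum>k\<in>A. of_real (c k) * cis (of_int k * t)))\<^sup>2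
      = (\<Sum>j\<in>A. \<Sum>k\<in>A. c j * c k * cos (of_int (j - k) * t))" for t
    unfolding cmod_power2
    by (simp add: power2_eq_square sum_product cos_diff algebra_simps flip: sum.distrib)
  have "((\<lambda>t. \<Sum>j\<in>A. \<Sum>k\<in>A. c j * c k * cos (of_int (j - k) * t)) has_integral
      (\<Sum>j\<in>A. \<Sum>k\<in>A. c j * c k * (if j - k = 0 then 2 * pi else 0))) {-pi..pi}"
    by (intro has_integral_sum assms has_integral_mult_right integral_cos_int)
  also have "(\<Sum>j\<in>A. \<Sum>k\<in>A. c j * c k * (if j - k = 0 then 2 * pi else 0)) = 2 * pi * (\<Sum>k\<in>A. (c k)\<^sup>2)"
    using assms by (simp add: sum_distrib_left power2_eq_square if_distrib cong: if_cong) (simp add: mult_ac)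
  finally show ?thesis unfolding eq .
qed

section \<open>The Fourier symbol\<close>

definition ksym :: "nat \<Rightarrow> (int \<Rightarrow> real) \<Rightarrow> real \<Rightarrow> complex" where
  "ksym n u t = (\<Sum>l = - int n..int n. of_real (u l) * cis (of_int l * t))"

text \<open>With transforms written as sums of \<open>f k * cis (k * t)\<close>, passing to
  \<open>f (k + 1)\<close> multiplies by \<open>cis (- t)\<close>; this explains the sign in the
  Laplacian factor.\<close>

definition symbol :: "nat \<Rightarrow> (int \<Rightarrow> real) \<Rightarrow> real \<Rightarrow> complex" where
  "symbol n u t = (cis (- t) - 1)\<^sup>2 * ksym n u t"

lemma cmod_symbol: "cmod (symbol n u t) = (2 - 2 * cos t) * cmod (ksym n u t)"
proof -
  have "(cmod (cis (- t) - 1))\<^sup>2 = (cos t - 1)\<^sup>2 + (sin t)\<^sup>2"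
    by (simp add: cmod_power2)
  also have "\<dots> = 2 - 2 * cos t"
    using sin_cos_squared_add[of t] by (simp add: power2_diff)
  finally show ?thesis by (simp add: symbol_def norm_mult norm_power)
qed

definition trig_sum :: "int \<Rightarrow> (int \<Rightarrow> real) \<Rightarrow> real \<Rightarrow> complex" where
  "trig_sum R f t = (\<Sum>k = - R..R. of_real (f k) * cis (of_int k * t))"

text \<open>The margin \<open>\<bar>m\<bar>\<close> keeps the shifted support inside the window, so
  reindexing loses no term.\<close>

lemma trig_sum_shift:
  assumes "\<And>k. \<bar>k\<bar> > R \<Longrightarrow> f k = 0" "R + \<bar>m\<bar> \<le> Q"
  shows "trig_sum Q (\<lambda>k. f (k + m)) t = cis (- (of_int m * t)) * trig_sum R f t"
proof -
  have "trig_sum Q (\<lambda>k. f (k + m)) t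
      = (\<Sum>k = - Q + m..Q + m. of_real (f k) * cis (of_int (k - m) * t))"
    unfolding trig_sum_def
    by (rule sum.reindex_bij_witness[of _ "\<lambda>k. k - m" "\<lambda>k. k + m"]) auto
  also have "\<dots> = (\<Sum>k = - R..R. of_real (f k) * cis (of_int (k - m) * t))"
    using assms by (intro sum.mono_neutral_right) auto
  also have "\<dots> = cis (- (of_int m * t)) * trig_sum R f t"
    unfolding trig_sum_def sum_distrib_left
    by (intro sum.cong refl) (simp add: cis_mult left_diff_distrib)
  finally show ?thesis .
qed

lemma convolve_support:
  assumes "\<And>k. \<bar>k\<bar> > R \<Longrightarrow> f k = 0" "\<bar>k\<bar> > R + int n"
  shows "convolve n u f k = 0"
  unfolding convolve_def using assms by (intro sum.neutral) auto

lemma laplacian_convolve_support: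
  assumes "\<And>k. \<bar>k\<bar> > R \<Longrightarrow> f k = 0" "\<bar>k\<bar> > R + int n + 2"
  shows "laplacian (convolve n u f) k = 0"
  unfolding laplacian_def using assms by (simp add: convolve_support[of R])

text \<open>Locality: the value at \<open>k\<close> reads \<open>f\<close> only within distance
  \<open>n + 2\<close> of \<open>k\<close>, so a distant cut-off of \<open>f\<close> is invisible
  there.\<close>

lemma laplacian_convolve_cong:
  assumes "\<And>j. \<bar>j\<bar> \<le> \<bar>k\<bar> + int n + 2 \<Longrightarrow> f j = g j"
  shows "laplacian (convolve n u f) k = laplacian (convolve n u g) k"
proof -
  have "convolve n u f i = convolve n u g i" if "i \<in> {k..k + 2}" for i
    unfolding convolve_def using that by (intro sum.cong) (auto intro!: assms)
  then show ?thesis by (simp add: laplacian_def)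
qed

text \<open>Convolution and Laplacian are combinations of shifts, which act by phase factors. The
  radius grows by \<open>n\<close> for the former and by \<open>2\<close> for the latter.\<close>

lemma trig_sum_laplacian_convolve:
  assumes "\<And>k. \<bar>k\<bar> > R \<Longrightarrow> f k = 0" "R + int n + 2 \<le> Q"
  shows "trig_sum Q (laplacian (convolve n u f)) t = symbol n u t * trig_sum R f t"
proof -
  define g where "g = convolve n u f"
  have conv: "trig_sum (R + int n) g t = ksym n u t * trig_sum R f t"
  proof -
    have "trig_sum (R + int n) g t
      = (\<Sum>l = - int n..int n. of_real (u l) * trig_sum (R + int n) (\<lambda>k. f (k + (- l))) t)"
      unfolding trig_sum_def g_def convolve_def
      by (simp only: of_real_sum sum_distrib_left sum_distrib_right of_real_mult mult.assoc diff_conv_add_uminus)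
        (rule sum.swap)
    also have "\<dots> = (\<Sum>l = - int n..int n. of_real (u l) * (cis (- (of_int (- l) * t)) * trig_sum R f t))"
      using assms by (intro sum.cong refl arg_cong2[where f = "(*)"] trig_sum_shift) auto
    also have "\<dots> = ksym n u t * trig_sum R f t"
      by (simp add: ksym_def sum_distrib_right mult.assoc)
    finally show ?thesis .
  qed
  have shift: "trig_sum Q (\<lambda>k. g (k + m)) t = cis (- (of_int m * t)) * trig_sum (R + int n) g t"
    if "\<bar>m\<bar> \<le> 2" for m
    using assms that by (intro trig_sum_shift) (auto simp: g_def intro: convolve_support[of R])
  have "trig_sum Q (laplacian g) t = trig_sum Q (\<lambda>k. g (k + 2)) t
      - 2 * trig_sum Q (\<lambda>k. g (k + 1)) t + trig_sum Q (\<lambda>k. g (k + 0)) t"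
    by (simp add: trig_sum_def laplacian_def algebra_simps sum.distrib sum_subtractf sum_distrib_left)
  also have "\<dots> = (cis (- t) - 1)\<^sup>2 * trig_sum (R + int n) g t"
    by (simp only: shift) (simp add: power2_diff algebra_simps cis_mult power2_eq_square)
  finally show ?thesis unfolding conv unfolding g_def symbol_def by (simp only: mult.assoc)
qed

text \<open>Parseval on both sides turns the pointwise bound on the symbol into a bound on
  energies.\<close>

lemma energy_le_finite_support:
  assumes supp: "\<And>k. \<bar>k\<bar> > R \<Longrightarrow> f k = 0"
    and bound: "\<And>t. cmod (symbol n u t) \<le> M"
  shows "(\<Sum>k = - (R + int n + 2)..R + int n + 2. (laplacian (convolve n u f) k)\<^sup>2)
    \<le> M\<^sup>2 * (\<Sum>k = - R..R. (f k)\<^sup>2)"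
proof -
  define Q where "Q = R + int n + 2"
  have "2 * pi * (\<Sum>k = - Q..Q. (laplacian (convolve n u f) k)\<^sup>2) \<le> M\<^sup>2 * (2 * pi * (\<Sum>k = - R..R. (f k)\<^sup>2))"
  proof (rule has_integral_le)
    show "((\<lambda>t. (cmod (trig_sum Q (laplacian (convolve n u f)) t))\<^sup>2) has_integral
        2 * pi * (\<Sum>k = - Q..Q. (laplacian (convolve n u f) k)\<^sup>2)) {-pi..pi}"
      unfolding trig_sum_def by (intro parseval_finite) simp
    show "((\<lambda>t. M\<^sup>2 * (cmod (trig_sum R f t))\<^sup>2) has_integral
        M\<^sup>2 * (2 * pi * (\<Sum>k = - R..R. (f k)\<^sup>2))) {-pi..pi}"
      unfolding trig_sum_def by (intro has_integral_mult_right parseval_finite) simp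
    fix t :: real
    have "(cmod (trig_sum Q (laplacian (convolve n u f)) t))\<^sup>2
        = (cmod (symbol n u t))\<^sup>2 * (cmod (trig_sum R f t))\<^sup>2"
      by (subst trig_sum_laplacian_convolve[of R]) (simp_all add: supp Q_def norm_mult power_mult_distrib)
    also have "\<dots> \<le> M\<^sup>2 * (cmod (trig_sum R f t))\<^sup>2"
      by (intro mult_right_mono power_mono bound) auto
    finally show "(cmod (trig_sum Q (laplacian (convolve n u f)) t))\<^sup>2
        \<le> M\<^sup>2 * (cmod (trig_sum R f t))\<^sup>2" .
  qed
  then show ?thesis unfolding Q_def[symmetric] by simp
qed

section \<open>Upper bound on all of \<open>ell2\<close>\<close>

lemma sum_squares_le_infsum:
  assumes "ell2 f" "finite F"
  shows "(\<Sum>k\<in>F. (f k)\<^sup>2) \<le> (ell2_norm f)\<^sup>2"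
proof -
  have "(ell2_norm f)\<^sup>2 = (\<Sum>\<^sub>\<infinity>k\<in>UNIV. (f k)\<^sup>2)"
    unfolding ell2_norm_def by (simp add: infsum_nonneg)
  then show ?thesis
    using assms by (simp add: ell2_def finite_sum_le_infsum)
qed

lemma finite_int_subset_interval:
  assumes "finite (F :: int set)"
  obtains N where "N \<ge> 0" "F \<subseteq> {-N..N}"
proof -
  have "F \<subseteq> {- (\<Sum>k\<in>F. \<bar>k\<bar>)..\<Sum>k\<in>F. \<bar>k\<bar>}"
  proof
    fix k assume "k \<in> F"
    then have "\<bar>k\<bar> \<le> (\<Sum>k\<in>F. \<bar>k\<bar>)" using assms by (intro member_le_sum) auto
    then show "k \<in> {- (\<Sum>k\<in>F. \<bar>k\<bar>)..\<Sum>k\<in>F. \<bar>k\<bar>}" by auto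
  qed
  then show thesis using that[of "\<Sum>k\<in>F. \<bar>k\<bar>"] by (simp add: sum_nonneg)
qed

text \<open>Each finite partial sum of the output energy sees only a truncation of \<open>f\<close>.
  The resulting bound is uniform in \<open>F\<close>, which gives both summability and the
  estimate.\<close>

lemma ell2_norm_laplacian_convolve_le:
  assumes f: "ell2 f" and bound: "\<And>t. cmod (symbol n u t) \<le> M"
  shows "ell2_norm (laplacian (convolve n u f)) \<le> M * ell2_norm f"
proof -
  have M: "M \<ge> 0" using bound[of 0] norm_ge_zero order.trans by blast
  have fin: "(\<Sum>k\<in>F. (laplacian (convolve n u f) k)\<^sup>2) \<le> (M * ell2_norm f)\<^sup>2" if "finite F" for F
  proof -
    obtain N where N: "N \<ge> 0" "F \<subseteq> {-N..N}" using finite_int_subset_interval[OF \<open>finite F\<close>] by blast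
    \<comment> \<open>All values of \<open>f\<close> that are read at places of \<open>F\<close> lie
      within this radius.\<close>
    define R where "R = N + int n + 2"
    define g where "g k = (if \<bar>k\<bar> \<le> R then f k else 0)" for k
    have "(\<Sum>k\<in>F. (laplacian (convolve n u f) k)\<^sup>2) = (\<Sum>k\<in>F. (laplacian (convolve n u g) k)\<^sup>2)"
    proof (intro sum.cong refl arg_cong[where f = power2] laplacian_convolve_cong)
      fix k j :: int assume "k \<in> F" "\<bar>j\<bar> \<le> \<bar>k\<bar> + int n + 2"
      then show "f j = g j" using N by (force simp: g_def R_def)
    qed
    also have "\<dots> \<le> (\<Sum>k = - (R + int n + 2)..R + int n + 2. (laplacian (convolve n u g) k)\<^sup>2)"
      using N by (intro sum_mono2) (auto simp: R_def)
    also have "\<dots> \<le> M\<^sup>2 * (\<Sum>k = - R..R. (g k)\<^sup>2)"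
      by (rule energy_le_finite_support[OF _ bound]) (simp add: g_def)
    also have "(\<Sum>k = - R..R. (g k)\<^sup>2) = (\<Sum>k = - R..R. (f k)\<^sup>2)"
      by (intro sum.cong) (auto simp: g_def)
    also have "M\<^sup>2 * \<dots> \<le> M\<^sup>2 * (ell2_norm f)\<^sup>2"
      using f by (intro mult_left_mono sum_squares_le_infsum) auto
    finally show ?thesis by (simp add: power_mult_distrib)
  qed
  have "(\<lambda>k. (laplacian (convolve n u f) k)\<^sup>2) summable_on UNIV"
    using fin by (intro nonneg_bdd_above_summable_on) (auto simp: bdd_above_def)
  then have "(\<Sum>\<^sub>\<infinity>k\<in>UNIV. (laplacian (convolve n u f) k)\<^sup>2) \<le> (M * ell2_norm f)\<^sup>2"
    using fin by (intro infsum_le_finite_sums) auto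
  then show ?thesis
    unfolding ell2_norm_def[of "laplacian _"] using M
    by (intro real_le_lsqrt) (auto simp: ell2_norm_def infsum_nonneg)
qed

section \<open>Lower bound through cut-off waves\<close>

lemma finite_support_ell2:
  assumes "\<And>k. \<bar>k\<bar> > R \<Longrightarrow> f k = 0"
  shows "ell2 f" "(ell2_norm f)\<^sup>2 = (\<Sum>k = - R..R. (f k)\<^sup>2)"
proof -
  have "(\<lambda>k. (f k)\<^sup>2) summable_on UNIV \<longleftrightarrow> (\<lambda>k. (f k)\<^sup>2) summable_on {-R..R}"
    using assms by (intro summable_on_cong_neutral) auto
  then show "ell2 f" by (simp add: ell2_def)
  have "(\<Sum>\<^sub>\<infinity>k\<in>UNIV. (f k)\<^sup>2) = (\<Sum>\<^sub>\<infinity>k\<in>{-R..R}. (f k)\<^sup>2)"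
    using assms by (intro infsum_cong_neutral) auto
  then show "(ell2_norm f)\<^sup>2 = (\<Sum>k = - R..R. (f k)\<^sup>2)"
    by (simp add: ell2_norm_def sum_nonneg)
qed

text \<open>The wave \<open>cis (k * t)\<close> is an eigenfunction, split here into two real
  sequences. Its eigenvalue is the conjugate of the symbol, since convolution yields phases
  \<open>cis (- l * t)\<close> and a shift yields \<open>cis t\<close>.\<close>

lemma laplacian_convolve_wave:
  "Complex (laplacian (convolve n u (\<lambda>k. cos (of_int k * t))) k)
           (laplacian (convolve n u (\<lambda>k. sin (of_int k * t))) k)
    = cis (of_int k * t) * cnj (symbol n u t)"
proof -
  have conv: "Complex (convolve n u (\<lambda>k. cos (of_int k * t)) k) (convolve n u (\<lambda>k. sin (of_int k * t)) k)
    = cis (of_int k * t) * cnj (ksym n u t)" for k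
  proof -
    have "Complex (convolve n u (\<lambda>k. cos (of_int k * t)) k) (convolve n u (\<lambda>k. sin (of_int k * t)) k)
      = (\<Sum>l = - int n..int n. of_real (u l) * cis (of_int (k - l) * t))"
      by (simp add: complex_eq_iff convolve_def)
    also have "\<dots> = cis (of_int k * t) * cnj (ksym n u t)"
      unfolding ksym_def cnj_sum sum_distrib_left
      by (intro sum.cong refl) (simp add: cis_cnj cis_mult left_diff_distrib)
    finally show ?thesis .
  qed
  have "Complex (laplacian (convolve n u (\<lambda>k. cos (of_int k * t))) k)
           (laplacian (convolve n u (\<lambda>k. sin (of_int k * t))) k)
     = Complex (convolve n u (\<lambda>k. cos (of_int k * t)) (k + 2)) (convolve n u (\<lambda>k. sin (of_int k * t)) (k + 2))
       - 2 * Complex (convolve n u (\<lambda>k. cos (of_int k * t)) (k + 1)) (convolve n u (\<lambda>k. sin (of_int k * t)) (k + 1))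
       + Complex (convolve n u (\<lambda>k. cos (of_int k * t)) k) (convolve n u (\<lambda>k. sin (of_int k * t)) k)"
    by (simp add: laplacian_def complex_eq_iff)
  also have "\<dots> = cis (of_int k * t) * (cis t - 1)\<^sup>2 * cnj (ksym n u t)"
    unfolding conv by (simp add: power2_diff distrib_right power2_eq_square algebra_simps flip: cis_mult)
      (simp add: cis_mult mult.commute)
  finally show ?thesis
    by (simp add: symbol_def cis_cnj)
qed

text \<open>A positive gap \<open>a - b\<close> would be multiplied by the unbounded
  \<open>2 * N + 1\<close>, while \<open>b * d\<close> stays constant.\<close>

lemma le_of_linear_growth:
  fixes a b d :: real
  assumes "\<And>N :: nat. a * (2 * real N + 1) \<le> b * (2 * real N + 1 + d)"
  shows "a \<le> b"
proof (rule ccontr)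
  assume "\<not> a \<le> b"
  then obtain N :: nat where "b * d / (a - b) < real N" using reals_Archimedean2 by blast
  then have "b * d < real N * (a - b)" using \<open>\<not> a \<le> b\<close> by (simp add: field_simps)
  then have "b * d < (2 * real N + 1) * (a - b)"
    using \<open>\<not> a \<le> b\<close> mult_right_mono[of "real N" "2 * real N + 1" "a - b"] by linarith
  then show False using assms[of N] by (simp add: algebra_simps)
qed

text \<open>Test functions: \<open>cos (k t)\<close> and \<open>sin (k t)\<close>, cut off at a large radius \<open>R\<close>; the cut-off affects
  boundedly many places while the energy grows linearly in \<open>R\<close>.\<close>

lemma cmod_symbol_le:
  assumes bound: "\<And>f. ell2 f \<Longrightarrow> f \<noteq> (\<lambda>_. 0) \<Longrightarrow> ell2_norm (laplacian (convolve n u f)) / ell2_norm f \<le> c"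
  shows "cmod (symbol n u t) \<le> c"
proof -
  \<comment> \<open>The hypothesis in quadratic form. The case \<open>f = 0\<close> is included
    because the sine test function vanishes when \<open>t\<close> is a multiple of
    \<open>pi\<close>.\<close>
  have fin: "(\<Sum>k = - N..N. (laplacian (convolve n u f) k)\<^sup>2) \<le> c\<^sup>2 * (\<Sum>k = - R..R. (f k)\<^sup>2)"
    if supp: "\<And>k. \<bar>k\<bar> > R \<Longrightarrow> f k = 0" for f N R
  proof (cases "f = (\<lambda>_. 0)")
    case True
    then show ?thesis by (simp add: laplacian_def convolve_def sum_nonneg)
  next
    case False
    then obtain k where "f k \<noteq> 0" by auto
    then have "0 < (\<Sum>k\<in>{k}. (f k)\<^sup>2)" by simp
    also have "\<dots> \<le> (ell2_norm f)\<^sup>2"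
      using finite_support_ell2(1)[OF supp] by (intro sum_squares_le_infsum) auto
    finally have "ell2_norm f > 0"
      by (simp add: ell2_norm_def infsum_nonneg less_le)
    then have "ell2_norm (laplacian (convolve n u f)) \<le> c * ell2_norm f"
      using bound[of f] False finite_support_ell2(1)[OF supp] by (simp add: divide_le_eq)
    moreover have "0 \<le> ell2_norm (laplacian (convolve n u f))"
      by (simp add: ell2_norm_def infsum_nonneg)
    ultimately have "(ell2_norm (laplacian (convolve n u f)))\<^sup>2 \<le> c\<^sup>2 * (ell2_norm f)\<^sup>2"
      using power_mono[of _ _ 2] by (metis power_mult_distrib)
    moreover have "(\<Sum>k = - N..N. (laplacian (convolve n u f) k)\<^sup>2) \<le> (ell2_norm (laplacian (convolve n u f)))\<^sup>2"
      by (intro sum_squares_le_infsum finite_support_ell2(1)[of "R + int n + 2"]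
          laplacian_convolve_support supp) auto
    ultimately show ?thesis by (simp add: finite_support_ell2(2)[OF supp])
  qed
  have "(cmod (symbol n u t))\<^sup>2 * (2 * real N + 1) \<le> c\<^sup>2 * (2 * real N + 1 + (2 * real n + 4))" for N :: nat
  proof -
    define R where "R = int N + int n + 2"
    define fc where "fc k = (if \<bar>k\<bar> \<le> R then cos (of_int k * t) else 0)" for k
    define fs where "fs k = (if \<bar>k\<bar> \<le> R then sin (of_int k * t) else 0)" for k
    \<comment> \<open>Together the two waves have the same output energy at every place where the
      cut-off is invisible.\<close>
    have "(laplacian (convolve n u fc) k)\<^sup>2 + (laplacian (convolve n u fs) k)\<^sup>2 = (cmod (symbol n u t))\<^sup>2"
      if "k \<in> {- int N..int N}" for k
    proof -
      have "laplacian (convolve n u fc) k = laplacian (convolve n u (\<lambda>k. cos (of_int k * t))) k"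
        "laplacian (convolve n u fs) k = laplacian (convolve n u (\<lambda>k. sin (of_int k * t))) k"
        using that by (intro laplacian_convolve_cong; auto simp: fc_def fs_def R_def)+
      then show ?thesis
        using arg_cong[OF laplacian_convolve_wave[of n u t k], of "\<lambda>z. (cmod z)\<^sup>2"]
        by (simp add: cmod_power2[of "Complex _ _"] norm_mult)
    qed
    then have "(cmod (symbol n u t))\<^sup>2 * (2 * real N + 1)
        = (\<Sum>k = - int N..int N. (laplacian (convolve n u fc) k)\<^sup>2 + (laplacian (convolve n u fs) k)\<^sup>2)"
      by simp
    also have "\<dots> \<le> c\<^sup>2 * (\<Sum>k = - R..R. (fc k)\<^sup>2) + c\<^sup>2 * (\<Sum>k = - R..R. (fs k)\<^sup>2)"
      unfolding sum.distrib by (intro add_mono fin) (auto simp: fc_def fs_def)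
    also have "\<dots> = c\<^sup>2 * (\<Sum>k = - R..R. (fc k)\<^sup>2 + (fs k)\<^sup>2)"
      by (simp add: sum.distrib algebra_simps)
    also have "(\<Sum>k = - R..R. (fc k)\<^sup>2 + (fs k)\<^sup>2) = (\<Sum>k = - R..R. 1)"
      by (intro sum.cong) (auto simp: fc_def fs_def)
    also have "(\<Sum>k = - R..R. 1) = 2 * real N + 1 + (2 * real n + 4)"
      by (simp add: R_def)
    finally show ?thesis .
  qed
  then have sq: "(cmod (symbol n u t))\<^sup>2 \<le> c\<^sup>2" by (rule le_of_linear_growth)
  \<comment> \<open>A unit impulse as test function shows \<open>0 \<le> c\<close>, which permits
    taking roots in \<open>sq\<close>.\<close>
  define \<delta> :: "int \<Rightarrow> real" where "\<delta> k = (if k = 0 then 1 else 0)" for k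
  have "0 \<le> ell2_norm (laplacian (convolve n u \<delta>)) / ell2_norm \<delta>"
    by (simp add: ell2_norm_def infsum_nonneg)
  also have "\<dots> \<le> c"
    by (rule bound) (auto simp: \<delta>_def fun_eq_iff intro!: finite_support_ell2(1)[of 0])
  finally show ?thesis using sq power2_le_imp_le by blast
qed

subsection \<open>The extremal problem\<close>

text \<open>As cosine is even, the places \<open>l\<close> and \<open>-l\<close> share one
  polynomial: the real part sees only the symmetric part of the kernel.\<close>

lemma Re_ksym: "Re (ksym n u t) = poly (\<Sum>l = - int n..int n. smult (u l) (Cheb (nat \<bar>l\<bar>))) (cos t)"
proof -
  have "poly (Cheb (nat \<bar>l\<bar>)) (cos t) = cos (of_int l * t)" for l
    by (cases "l \<ge> 0") (simp_all add: poly_Cheb_cos)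
  then show ?thesis by (simp add: ksym_def poly_sum)
qed

lemma sum_symmetric_interval:
  fixes g :: "int \<Rightarrow> real"
  shows "(\<Sum>l = - int n..int n. g l) = g 0 + (\<Sum>m = 1..n. g (int m) + g (- int m))"
proof (induction n)
  case (Suc n)
  have "{- int (Suc n)..int (Suc n)} = insert (- int (Suc n)) (insert (int (Suc n)) {- int n..int n})"
    by auto
  then show ?case using Suc by simp
qed simp

text \<open>As sine is odd, the imaginary part sees only the antisymmetric part.\<close>

lemma Im_ksym: "Im (ksym n u t) = (\<Sum>m = 1..n. (u (int m) - u (- int m)) * sin (real m * t))"
proof -
  have "Im (ksym n u t) = (\<Sum>l = - int n..int n. u l * sin (of_int l * t))"
    by (simp add: ksym_def)
  then show ?thesis by (simp add: sum_symmetric_interval algebra_simps)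
qed

text \<open>Recovers the symmetric part of the kernel from the polynomial in \<open>Re_ksym\<close>;
  at \<open>k = 0\<close> the mean is just \<open>u 0\<close>.\<close>

lemma cheb_coeff_kernel:
  assumes "k \<le> n"
  shows "cheb_coeff k (\<Sum>l = - int n..int n. smult (u l) (Cheb (nat \<bar>l\<bar>))) = (u (int k) + u (- int k)) / 2"
proof -
  have "(\<Sum>m = 1..n. (if m = k then if k = 0 then b m else b m / 2 else 0) + (if m = k then if k = 0 then c m else c m / 2 else 0))
     = (if k = 0 then 0 else (b k + c k) / 2)" for b c :: "nat \<Rightarrow> real"
  proof -
    have "(\<Sum>m = 1..n. (if m = k then if k = 0 then b m else b m / 2 else 0) + (if m = k then if k = 0 then c m else c m / 2 else 0))
       = (\<Sum>m = 1..n. if m = k then if k = 0 then b k + c k else (b k + c k) / 2 else 0)"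
      by (intro sum.cong) (auto simp: add_divide_distrib)
    then show ?thesis using assms by (simp add: sum.delta)
  qed
  from this[of "\<lambda>m. u (int m)" "\<lambda>m. u (- int m)"] show ?thesis
    by (subst cheb_coeff_sum) (auto simp: sum_symmetric_interval)
qed

section \<open>Nodes and equioscillation\<close>

definition node_angle :: "nat \<Rightarrow> real" where "node_angle n = pi / (2 * real n + 2)"

text \<open>The affine map inside \<open>S_num\<close> fixes \<open>-1\<close> and sends
  \<open>1\<close> to \<open>cos (node_angle n)\<close>, the largest zero of
  \<open>Cheb (n + 1)\<close>. The nodes are the preimages of its extremal points
  \<open>cos ((j + 1) * pi / (n + 1))\<close>; \<open>Suc j\<close> skips the extremal point
  \<open>1\<close>, whose preimage exceeds \<open>1\<close>.\<close>

definition node :: "nat \<Rightarrow> nat \<Rightarrow> real" where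
  "node n j = 2 * (cos (real (Suc j) * (2 * node_angle n)) + 1) / (1 + cos (node_angle n)) - 1"

definition opt_value :: "nat \<Rightarrow> real" where
  "opt_value n = 4 / (real n + 1) * (sin (node_angle n) / (1 + cos (node_angle n)))"

lemma node_angle_bounds:
  assumes "n \<ge> 1"
  shows "0 < node_angle n" "node_angle n < pi / 2" "real (Suc n) * (2 * node_angle n) = pi"
    "0 < sin (node_angle n)" "0 < cos (node_angle n)"
proof -
  show 1: "0 < node_angle n" by (simp add: node_angle_def add_pos_pos)
  show 2: "node_angle n < pi / 2" using assms by (simp add: node_angle_def divide_simps)
  show "real (Suc n) * (2 * node_angle n) = pi" by (simp add: node_angle_def divide_simps) 
  show "0 < sin (node_angle n)" "0 < cos (node_angle n)"
    using 1 2 by (auto intro!: sin_gt_zero cos_gt_zero)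
qed

lemma opt_value_pos: "n \<ge> 1 \<Longrightarrow> 0 < opt_value n"
  using node_angle_bounds[of n] by (auto simp: opt_value_def intro!: mult_pos_pos divide_pos_pos)

lemma node_bounds:
  assumes n: "n \<ge> 1"
  shows "j \<le> n \<Longrightarrow> -1 \<le> node n j" "j \<le> n \<Longrightarrow> node n j < 1" "j < n \<Longrightarrow> -1 < node n j"
    "i < j \<Longrightarrow> j \<le> n \<Longrightarrow> node n j < node n i"
proof -
  note b = node_angle_bounds[OF n]
  have ang: "real (Suc j) * (2 * node_angle n) \<le> pi" if "j \<le> n" for j
  proof -
    have "real (Suc j) * (2 * node_angle n) \<le> real (Suc n) * (2 * node_angle n)"
      using that b by (intro mult_right_mono) auto
    then show ?thesis by (simp only: b(3))
  qed
  have ang': "real (Suc j) * (2 * node_angle n) < pi" if "j < n" for j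
  proof -
    have "real (Suc j) * (2 * node_angle n) < real (Suc n) * (2 * node_angle n)"
      using that b by (intro mult_strict_right_mono) auto
    then show ?thesis by (simp only: b(3))
  qed
  have "0 \<le> 2 * (cos (real (Suc j) * (2 * node_angle n)) + 1) / (1 + cos (node_angle n))"
  proof (rule divide_nonneg_pos)
    have "-1 \<le> c \<Longrightarrow> 0 \<le> 2 * (c + 1)" for c :: real by simp
    from this[OF cos_ge_minus_one] show "0 \<le> 2 * (cos (real (Suc j) * (2 * node_angle n)) + 1)" .
    show "0 < 1 + cos (node_angle n)" using b by linarith
  qed
  then show "j \<le> n \<Longrightarrow> -1 \<le> node n j" by (simp only: node_def)
  show "node n j < 1" if "j \<le> n"
  proof -
    have "node_angle n < real (Suc j) * (2 * node_angle n)"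
      using b by (simp add: distrib_right add_pos_nonneg)
    then have "cos (real (Suc j) * (2 * node_angle n)) < cos (node_angle n)"
      using b ang[OF that] by (intro cos_monotone_0_pi) auto
    then show ?thesis using b by (simp add: node_def field_simps)
  qed
  have cos_less: "cos (real (Suc j) * (2 * node_angle n)) < cos (real (Suc i) * (2 * node_angle n))"
    if "i < j" "j \<le> n" for i j
    using b ang[OF that(2)] that
    by (intro cos_monotone_0_pi mult_strict_right_mono mult_nonneg_nonneg) auto
  show "i < j \<Longrightarrow> j \<le> n \<Longrightarrow> node n j < node n i"
    using cos_less[of i j] b by (simp add: node_def divide_simps)
  show "-1 < node n j" if "j < n"
  proof -
    have "cos pi < cos (real (Suc j) * (2 * node_angle n))"
      using b ang'[OF that] by (intro cos_monotone_0_pi mult_nonneg_nonneg) auto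
    then show ?thesis using b by (simp add: node_def)
  qed
qed

lemma poly_S_num:
  "poly (S_num n) x = opt_value n / 2 * poly (Cheb (n + 1)) ((1 + cos (node_angle n)) / 2 * (x + 1) - 1)"
proof -
  have "poly [:a - 1, a:] x = a * (x + 1) - 1" for a :: real by (simp add: algebra_simps)
  moreover have "2 * s / ((real n + 1) * (1 + c)) = 4 / (real n + 1) * (s / (1 + c)) / 2" for s c :: real
    by simp
  ultimately show ?thesis
    by (simp only: S_num_def Let_def poly_smult poly_pcompose opt_value_def node_angle_def)
qed

lemma poly_S_poly_mult: "(x - 1) * poly (S_poly n) x = poly (S_num n) x"
  by (subst S_poly_exact[symmetric]) (simp add: algebra_simps)

text \<open>The affine map takes the node to an extremal point, where \<open>Cheb (n + 1)\<close> is
  \<open>cos ((j + 1) * pi)\<close>.\<close>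

lemma poly_S_num_node:
  assumes "n \<ge> 1" "j \<le> n"
  shows "poly (S_num n) (node n j) = - opt_value n / 2 * (-1) ^ j"
proof -
  note b = node_angle_bounds[OF assms(1)]
  have "(1 + cos (node_angle n)) / 2 * (node n j + 1) - 1 = cos (real (Suc j) * (2 * node_angle n))"
  proof -
    have "s / 2 * (2 * (c + 1) / s - 1 + 1) - 1 = c" if "s > 0" for s c :: real
      using that by (simp add: field_simps)
    then show ?thesis using b by (simp only: node_def add_pos_pos zero_less_one)
  qed
  then have "poly (S_num n) (node n j) = opt_value n / 2 * cos (real (n + 1) * (real (Suc j) * (2 * node_angle n)))"
    by (simp only: poly_S_num poly_Cheb_cos)
  also have "real (n + 1) * (real (Suc j) * (2 * node_angle n)) = real (Suc j) * pi"
    using b(3) by (simp add: mult.left_commute)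
  also have "cos (real (Suc j) * pi) = (-1) ^ Suc j" by (rule cos_npi)
  finally show ?thesis by simp
qed

text \<open>The affine map takes \<open>[-1, 1]\<close> into itself, and \<open>Cheb (n + 1)\<close>
  is bounded by \<open>1\<close> there.\<close>

lemma abs_poly_S_num_le:
  assumes "n \<ge> 1" "\<bar>x\<bar> \<le> 1"
  shows "\<bar>poly (S_num n) x\<bar> \<le> opt_value n / 2"
proof -
  note b = node_angle_bounds[OF assms(1)]
  define y where "y = (1 + cos (node_angle n)) / 2 * (x + 1) - 1"
  have "(1 + cos (node_angle n)) / 2 * (x + 1) \<le> 1 * 2"
    using assms cos_le_one[of "node_angle n"] b by (intro mult_mono) auto
  moreover have "0 \<le> (1 + cos (node_angle n)) / 2 * (x + 1)"
    using assms b by (intro mult_nonneg_nonneg) auto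
  ultimately have "\<bar>y\<bar> \<le> 1" unfolding y_def by linarith
  then have "\<bar>poly (Cheb (n + 1)) y\<bar> \<le> 1" by (simp only: Cheb_arccos abs_cos_le_one)
  then have "opt_value n / 2 * \<bar>poly (Cheb (n + 1)) y\<bar> \<le> opt_value n / 2 * 1"
    using opt_value_pos[OF assms(1)] by (intro mult_left_mono) auto
  then show ?thesis
    using opt_value_pos[OF assms(1)] by (simp add: poly_S_num y_def abs_mult)
qed

lemma degree_S_poly: "degree (S_poly n) \<le> n"
proof (cases "S_poly n = 0")
  case False
  have "degree (S_num n) = degree [:-1, 1:: real:] + degree (S_poly n)"
    by (subst S_poly_exact[symmetric], rule degree_mult_eq) (use False in auto)
  moreover have "degree (S_num n) \<le> n + 1"
    unfolding S_num_def Let_def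
    using degree_Cheb_le[of "n + 1"]
    by (intro order.trans[OF degree_smult_le]) (simp only: degree_pcompose, auto simp: mult_le_cancel1)
  ultimately show ?thesis by simp
qed simp

text \<open>The value is the derivative of \<open>(x - 1) * S_n(x)\<close> at \<open>1\<close>,
  where the affine map reaches a zero of \<open>Cheb (n + 1)\<close> with slope
  \<open>(n + 1) / sin t\<close>. The constant in \<open>S_num\<close> normalizes the product to
  \<open>1\<close>.\<close>

lemma poly_S_poly_1:
  assumes "n \<ge> 1"
  shows "poly (S_poly n) 1 = 1"
proof -
  note b = node_angle_bounds[OF assms]
  define t where "t = node_angle n"
  have "pderiv (S_num n) = pderiv ([:-1, 1:] * S_poly n)" by (simp only: S_poly_exact)
  then have "poly (S_poly n) 1 = poly (pderiv (S_num n)) 1"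
    by (simp only: pderiv_mult poly_add poly_mult) (simp add: pderiv_pCons)
  moreover have "((\<lambda>x. poly (S_num n) x) has_real_derivative
      opt_value n / 2 * (poly (pderiv (Cheb (n + 1))) ((1 + cos t) / 2 * (1 + 1) - 1) * ((1 + cos t) / 2))) (at 1)"
    unfolding poly_S_num t_def
    by (intro DERIV_cmult DERIV_chain2[OF poly_DERIV]) (auto intro!: derivative_eq_intros)
  ultimately have "poly (S_poly n) 1
      = opt_value n / 2 * (poly (pderiv (Cheb (n + 1))) ((1 + cos t) / 2 * (1 + 1) - 1) * ((1 + cos t) / 2))"
    using DERIV_unique[OF poly_DERIV] by metis
  also have "(1 + cos t) / 2 * (1 + 1) - 1 = cos t" by (simp add: field_simps)
  also have "poly (pderiv (Cheb (n + 1))) (cos t) = (real n + 1) / sin t"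
  proof -
    have "real (n + 1) * t = pi / 2" using b(3) by (simp add: t_def)
    then have "poly (pderiv (Cheb (n + 1))) (cos t) * sin t = real (n + 1) * sin (pi / 2)"
      by (simp only: poly_pderiv_Cheb_cos)
    then show ?thesis using b by (simp add: t_def eq_divide_eq)
  qed
  also have "opt_value n / 2 * ((real n + 1) / sin t * ((1 + cos t) / 2)) = 1"
    using b by (simp add: opt_value_def t_def divide_simps add_eq_0_iff)
  finally show ?thesis .
qed

section \<open>Uniqueness of the extremal polynomial\<close>

lemma abs_diff_1_mult:
  fixes x y :: real
  assumes "x \<le> 1"
  shows "2 * \<bar>(x - 1) * y\<bar> = (2 - 2 * x) * \<bar>y\<bar>"
  using assms by (simp only: abs_mult abs_of_nonpos diff_le_0_iff_le) (simp add: algebra_simps)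

text \<open>Chebyshev's equioscillation argument: at the nodes \<open>S_poly n\<close> attains the bound with alternating
  signs, so the difference to \<open>p\<close>, divided by \<open>x - 1\<close>, alternates weakly at more points than its degree
  permits.\<close>

lemma extremal_poly_unique:
  assumes n: "n \<ge> 1" and deg: "degree p \<le> n" and p1: "poly p 1 = 1"
    and bound: "\<And>x. \<bar>x\<bar> \<le> 1 \<Longrightarrow> (2 - 2 * x) * \<bar>poly p x\<bar> \<le> opt_value n"
  shows "p = S_poly n"
proof -
  define d where "d = p - S_poly n"
  have "poly d 1 = 0" using p1 poly_S_poly_1[OF n] by (simp add: d_def)
  then obtain e where e: "d = [:-1, 1:] * e" by (auto simp: poly_eq_0_iff_dvd elim: dvdE)
  have "e = 0"
  proof (cases "e = 0")
    case False
    have "degree d \<le> n" unfolding d_def using deg degree_S_poly by (rule degree_diff_le)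
    moreover have "degree d = degree [:-1, 1:: real:] + degree e"
      unfolding e by (rule degree_mult_eq) (use False in auto)
    ultimately have dege: "degree e < n" by simp
    show ?thesis
    proof (rule alternating_imp_zero[where x = "node n", OF _ dege])
      fix j assume j: "j \<le> n"
      define x where "x = node n j"
      have x: "-1 \<le> x" "x < 1" using node_bounds(1,2)[OF n j] by (auto simp: x_def)
      \<comment> \<open>At a node \<open>S_num\<close> has the maximal modulus
        \<open>opt_value n / 2\<close>, so the right side has the sign of \<open>- S_num\<close> or
        vanishes; the positive square passes this on to \<open>e\<close>.\<close>
      have eq: "(x - 1)\<^sup>2 * poly e x = (x - 1) * poly p x - poly (S_num n) x"
      proof -
        have "(x - 1)\<^sup>2 * poly e x = (x - 1) * poly d x" by (simp add: e power2_eq_square algebra_simps)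
        then show ?thesis by (simp add: d_def right_diff_distrib poly_S_poly_mult)
      qed
      have "\<bar>(x - 1) * poly p x\<bar> \<le> opt_value n / 2"
        
      proof -
        have "\<bar>x\<bar> \<le> 1" using x by simp
        from bound[OF this] show ?thesis using abs_diff_1_mult[of x "poly p x"] x by linarith
      qed
      moreover have "poly (S_num n) x = - opt_value n / 2 * (-1) ^ j"
        unfolding x_def by (rule poly_S_num_node[OF n j])
      ultimately have "0 \<le> (-1) ^ j * ((x - 1)\<^sup>2 * poly e x)"
        unfolding eq by (cases "even j") (auto simp: abs_le_iff)
      then have "0 \<le> (x - 1)\<^sup>2 * ((-1) ^ j * poly e x)" by (simp only: mult.left_commute)
      moreover have "(x - 1)\<^sup>2 > 0" using x by simp
      ultimately show "0 \<le> (-1) ^ j * poly e (node n j)"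
        unfolding x_def by (simp only: zero_le_mult_iff not_less) auto
    qed (use node_bounds(4)[OF n] in auto)
  qed
  then show ?thesis using e by (simp add: d_def)
qed

text \<open>The sine sum is \<open>sin t\<close> times \<open>P'(cos t)\<close> with \<open>P = \<Sum> (b\<^sub>m / m) T\<^sub>m\<close>, and \<open>P'\<close> has degree less
  than \<open>n\<close>.\<close>

lemma sin_sum_zero_imp_coeff_zero:
  assumes A: "A \<subseteq> {0<..<pi}" "card A \<ge> n" "finite A"
    and zero: "\<And>t. t \<in> A \<Longrightarrow> (\<Sum>m = 1..n. b m * sin (real m * t)) = 0"
    and k: "k \<in> {1..n}"
  shows "b k = 0"
proof -
  define P where "P = (\<Sum>m = 1..n. smult (b m / real m) (Cheb m))"
  have P: "poly (pderiv P) (cos t) * sin t = (\<Sum>m = 1..n. b m * sin (real m * t))" for t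
    unfolding P_def higher_pderiv_sum[where n = 1, simplified] poly_sum sum_distrib_right
    by (intro sum.cong refl) (auto simp: pderiv_smult mult.assoc poly_pderiv_Cheb_cos)
  have "inj_on cos A"
    using A by (intro inj_onI) (meson cos_inj_pi greaterThanLessThan_iff less_imp_le subsetD)
  then have card: "card (cos ` A) \<ge> n" using A by (simp add: card_image)
  have "degree P \<le> n" unfolding P_def
    by (intro degree_sum_le) (auto intro!: order.trans[OF degree_smult_le] order.trans[OF degree_Cheb_le])
  then have "degree (pderiv P) < n" using k degree_pderiv[of P] by auto
  then have "pderiv P = 0"
  proof (intro poly_eqI_degree[of "cos ` A"])
    fix x assume "x \<in> cos ` A"
    then obtain t where t: "t \<in> A" "x = cos t" by auto
    then have "t \<in> {0<..<pi}" using A by blast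
    then have "sin t > 0" by (simp add: sin_gt_zero)
    then show "poly (pderiv P) x = poly 0 x" using P[of t] zero[OF t(1)] t by simp
  qed (use card in auto)
  then obtain c where "P = [:c:]" by (metis pderiv_iszero)
  \<comment> \<open>Written as a multiple of \<open>Cheb 0\<close>, the constant has no Chebyshev
    coefficient of index \<open>k \<ge> 1\<close>.\<close>
  then have "P = (\<Sum>m\<in>{0::nat}. smult c (Cheb m))" by simp
  moreover have "cheb_coeff k (\<Sum>m\<in>{0::nat}. smult c (Cheb m)) = 0"
    using k by (subst cheb_coeff_sum) auto
  ultimately have "cheb_coeff k P = 0" by (simp only:)
  moreover have "cheb_coeff k P = b k / real k / 2"
    unfolding P_def using k by (subst cheb_coeff_sum) (auto simp: sum.delta)
  ultimately show ?thesis using k by auto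
qed

text \<open>Uniqueness for the real part fixes \<open>u k + u (- k)\<close>. Where the real part
  alone attains the bound, no room is left for an imaginary part, and these zeros force
  \<open>u k = u (- k)\<close>.\<close>

lemma opt_kernel_of_symbol_bound:
  assumes n: "n \<ge> 1" and sum1: "(\<Sum>l = - int n..int n. u l) = 1"
    and bound: "\<And>t. cmod (symbol n u t) \<le> opt_value n"
    and k: "k \<in> {- int n..int n}"
  shows "u k = opt_kernel n k"
proof -
  define p where "p = (\<Sum>l = - int n..int n. smult (u l) (Cheb (nat \<bar>l\<bar>)))"
  have "p = S_poly n"
  proof (rule extremal_poly_unique[OF n])
    show "degree p \<le> n" unfolding p_def
      by (intro degree_sum_le) (auto intro!: order.trans[OF degree_smult_le] order.trans[OF degree_Cheb_le])
    show "poly p 1 = 1" by (simp add: p_def poly_sum poly_Cheb_1 sum1)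
    fix x :: real assume x: "\<bar>x\<bar> \<le> 1"
    have "(2 - 2 * x) * \<bar>poly p x\<bar> \<le> (2 - 2 * x) * cmod (ksym n u (arccos x))"
      using x abs_Re_le_cmod[of "ksym n u (arccos x)"]
      by (intro mult_left_mono) (auto simp: Re_ksym p_def cos_arccos_abs)
    then show "(2 - 2 * x) * \<bar>poly p x\<bar> \<le> opt_value n"
      using bound[of "arccos x"] x by (simp add: cmod_symbol cos_arccos_abs)
  qed
  then have sym: "opt_kernel n l = (u \<bar>l\<bar> + u (- \<bar>l\<bar>)) / 2" if "\<bar>l\<bar> \<le> int n" for l
    using cheb_coeff_kernel[of "nat \<bar>l\<bar>" n u] that by (simp add: opt_kernel_eq p_def)
  \<comment> \<open>The node \<open>-1\<close> is left out: its angle \<open>pi\<close> is a zero of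
    every sine sum. The other \<open>n\<close> nodes match the \<open>n\<close> unknown
    differences.\<close>
  have Im0: "Im (ksym n u (arccos (node n j))) = 0" if "j < n" for j
  proof -
    define x where "x = node n j"
    have x: "-1 < x" "x < 1" using node_bounds(2,3)[OF n] that by (auto simp: x_def)
    define z where "z = ksym n u (arccos x)"
    have "Re z = poly (S_poly n) x"
      using x by (simp add: z_def Re_ksym \<open>p = S_poly n\<close>[unfolded p_def])
    then have "(x - 1) * Re z = - opt_value n / 2 * (-1) ^ j"
      using poly_S_num_node[OF n, of j] that by (simp add: poly_S_poly_mult x_def)
    then have "\<bar>(x - 1) * Re z\<bar> = opt_value n / 2"
      using opt_value_pos[OF n] by (simp add: abs_mult)
    then have "(2 - 2 * x) * \<bar>Re z\<bar> = opt_value n"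
      using x abs_diff_1_mult[of x "Re z"] by simp
    moreover have "(2 - 2 * x) * cmod z \<le> opt_value n"
      using bound[of "arccos x"] x by (simp add: cmod_symbol z_def)
    ultimately have "(2 - 2 * x) * cmod z \<le> (2 - 2 * x) * \<bar>Re z\<bar>" by simp
    then have "cmod z \<le> \<bar>Re z\<bar>" using x by simp
    then have "(cmod z)\<^sup>2 \<le> (Re z)\<^sup>2" using power_mono[of "cmod z" "\<bar>Re z\<bar>" 2] by simp
    then show ?thesis by (simp add: cmod_power2 z_def x_def)
  qed
  define A where "A = (\<lambda>j. arccos (node n j)) ` {..<n}"
  have "inj_on (\<lambda>j. arccos (node n j)) {..<n}"
  proof (rule linorder_inj_onI)
    fix i j assume "i < j" "i \<in> {..<n}" "j \<in> {..<n}"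
    then have "arccos (node n i) < arccos (node n j)"
      using node_bounds[OF n] by (intro arccos_less_arccos) (auto simp: less_imp_le)
    then show "arccos (node n i) \<noteq> arccos (node n j)" by simp
  qed auto
  then have "card A = n" by (simp add: A_def card_image)
  moreover have "A \<subseteq> {0<..<pi}"
    using node_bounds[OF n] by (auto simp: A_def intro!: arccos_lt_bounded[THEN conjunct1] arccos_lt_bounded[THEN conjunct2])
  ultimately have "u (int m) - u (- int m) = 0" if "m \<in> {1..n}" for m
    using that Im0
    by (intro sin_sum_zero_imp_coeff_zero[of A n "\<lambda>m. u (int m) - u (- int m)" m])
      (auto simp: A_def Im_ksym)
  moreover have "nat \<bar>k\<bar> \<in> {1..n}" if "k \<noteq> 0" using k that by auto
  ultimately have "u \<bar>k\<bar> = u (- \<bar>k\<bar>)" by (cases "k = 0") fastforce+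
  then show ?thesis using sym[of k] k by (auto simp: abs_if split: if_splits)
qed

section \<open>The symbol of the optimal kernel\<close>

lemma ksym_opt_kernel:
  assumes "\<And>k. k \<in> {- int n..int n} \<Longrightarrow> u k = opt_kernel n k"
  shows "ksym n u t = of_real (poly (S_poly n) (cos t))"
proof (rule complex_eqI)
  obtain a where a: "S_poly n = (\<Sum>m\<le>n. smult (a m) (Cheb m))"
    using Cheb_expansion[OF degree_S_poly] by blast
  \<comment> \<open>For \<open>k \<noteq> 0\<close> the kernel holds half a coefficient at each of
    \<open>k\<close> and \<open>-k\<close>; the cosine sum adds the halves and the sine sum cancels
    them.\<close>
  have u: "u k = (if k = 0 then a 0 else a (nat \<bar>k\<bar>) / 2)" if "k \<in> {- int n..int n}" for k
  proof -
    have "u k = (\<Sum>m\<le>n. if m = nat \<bar>k\<bar> then (if nat \<bar>k\<bar> = 0 then a m else a m / 2) else 0)"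
      by (simp only: assms[OF that] opt_kernel_eq a cheb_coeff_sum finite_atMost)
    also have "\<dots> = (\<Sum>m\<le>n. if m = nat \<bar>k\<bar> then (if k = 0 then a 0 else a (nat \<bar>k\<bar>) / 2) else 0)"
      by (intro sum.cong) auto
    moreover have "nat \<bar>k\<bar> \<le> n" using that by auto
    ultimately show ?thesis by (simp add: sum.delta)
  qed
  have "Re (ksym n u t) = (\<Sum>l = - int n..int n. u l * poly (Cheb (nat \<bar>l\<bar>)) (cos t))"
    by (simp add: Re_ksym poly_sum)
  also have "\<dots> = a 0 + (\<Sum>m = 1..n. a m * poly (Cheb m) (cos t))"
    unfolding sum_symmetric_interval
    by (intro arg_cong2[where f = "(+)"] sum.cong refl) (auto simp: u)
  also have "\<dots> = poly (S_poly n) (cos t)"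
    by (simp add: a poly_sum sum.atMost_shift sum.atLeast1_atMost_eq atLeast0AtMost lessThan_Suc_atMost)
  finally show "Re (ksym n u t) = Re (of_real (poly (S_poly n) (cos t)))" by simp
  show "Im (ksym n u t) = Im (of_real (poly (S_poly n) (cos t)))"
    by (simp add: Im_ksym u)
qed

lemma cmod_symbol_opt_kernel:
  assumes "\<And>k. k \<in> {- int n..int n} \<Longrightarrow> u k = opt_kernel n k"
  shows "cmod (symbol n u t) = 2 * \<bar>poly (S_num n) (cos t)\<bar>"
proof -
  have "cmod (symbol n u t) = 2 * \<bar>(cos t - 1) * poly (S_poly n) (cos t)\<bar>"
    using cos_le_one[of t] ksym_opt_kernel[OF assms, of t] by (simp add: cmod_symbol abs_diff_1_mult)
  then show ?thesis by (simp add: poly_S_poly_mult)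
qed

lemma cmod_symbol_opt_kernel_le:
  assumes "n \<ge> 1" "\<And>k. k \<in> {- int n..int n} \<Longrightarrow> u k = opt_kernel n k"
  shows "cmod (symbol n u t) \<le> opt_value n"
  using abs_poly_S_num_le[OF assms(1), of "cos t"] cmod_symbol_opt_kernel[of n u t] assms(2) by auto

text \<open>The frequency \<open>pi\<close> corresponds to the last node \<open>-1\<close>.\<close>

lemma cmod_symbol_opt_kernel_pi:
  assumes "n \<ge> 1" "\<And>k. k \<in> {- int n..int n} \<Longrightarrow> u k = opt_kernel n k"
  shows "cmod (symbol n u pi) = opt_value n"
proof -
  have "node n n = -1"
    using node_angle_bounds(3)[OF assms(1)] by (simp only: node_def cos_pi) simp
  then have "\<bar>poly (S_num n) (-1)\<bar> = opt_value n / 2"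
    using poly_S_num_node[OF assms(1), of n] opt_value_pos[OF assms(1)] by (simp add: abs_mult)
  then show ?thesis using cmod_symbol_opt_kernel[of n u pi] assms(2) by simp
qed

theorem theorem1:
  fixes n :: nat and u :: "int \<Rightarrow> real"
  assumes "n \<ge> 1"
    and "(\<Sum>l = - int n..int n. u l) = 1"
  shows "(SUP f\<in>{f. ell2 f \<and> f \<noteq> (\<lambda>_. 0)}. ereal (ell2_norm (laplacian (convolve n u f)) / ell2_norm f))
      \<ge> ereal (4 / (real n + 1) * (sin (pi / (2 * real n + 2)) / (1 + cos (pi / (2 * real n + 2)))))
    \<and> ((SUP f\<in>{f. ell2 f \<and> f \<noteq> (\<lambda>_. 0)}. ereal (ell2_norm (laplacian (convolve n u f)) / ell2_norm f))
        = ereal (4 / (real n + 1) * (sin (pi / (2 * real n + 2)) / (1 + cos (pi / (2 * real n + 2)))))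
      \<longleftrightarrow> (\<forall>k\<in>{- int n..int n}. u k = opt_kernel n k))"
proof -
  note n = assms(1)
  define \<rho> where "\<rho> f = ell2_norm (laplacian (convolve n u f)) / ell2_norm f" for f
  define B where "B = (SUP f\<in>{f. ell2 f \<and> f \<noteq> (\<lambda>_. 0)}. ereal (\<rho> f))"
  have sym_le: "cmod (symbol n u t) \<le> c" if "B \<le> ereal c" for c t
  proof (rule cmod_symbol_le)
    fix f assume "ell2 f" "f \<noteq> (\<lambda>_. 0)"
    then have "ereal (\<rho> f) \<le> B" unfolding B_def by (intro SUP_upper) auto
    with that have "ereal (\<rho> f) \<le> ereal c" by (rule order.trans[rotated])
    then show "ell2_norm (laplacian (convolve n u f)) / ell2_norm f \<le> c" by (simp add: \<rho>_def)
  qed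
  have opt: "u k = opt_kernel n k" if "B \<le> ereal (opt_value n)" "k \<in> {- int n..int n}" for k
    using opt_kernel_of_symbol_bound[OF n assms(2)] sym_le that by blast
  \<comment> \<open>The lower bound follows from uniqueness: a smaller \<open>B\<close> would force
    \<open>u\<close> to be the optimal kernel, whose symbol at \<open>pi\<close> has modulus
    \<open>opt_value n\<close>, above the intermediate \<open>c\<close>.\<close>
  have lower: "ereal (opt_value n) \<le> B"
  proof (rule ccontr)
    assume "\<not> ereal (opt_value n) \<le> B"
    then obtain c where c: "B < ereal c" "ereal c < ereal (opt_value n)"
      using ereal_dense2 by (metis not_le)
    then have "B \<le> ereal (opt_value n)" by (meson less_imp_le less_trans)
    then have "cmod (symbol n u pi) = opt_value n"
      by (intro cmod_symbol_opt_kernel_pi[OF n] opt) auto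
    moreover have "cmod (symbol n u pi) \<le> c" using c by (intro sym_le) auto
    ultimately show False using c by simp
  qed
  have upper: "B \<le> ereal (opt_value n)" if "\<forall>k\<in>{- int n..int n}. u k = opt_kernel n k"
    unfolding B_def
  proof (rule SUP_least)
    fix f assume "f \<in> {f. ell2 f \<and> f \<noteq> (\<lambda>_. 0)}"
    then have "ell2_norm (laplacian (convolve n u f)) \<le> opt_value n * ell2_norm f"
      using that by (intro ell2_norm_laplacian_convolve_le cmod_symbol_opt_kernel_le[OF n]) auto
    moreover have "0 \<le> ell2_norm f" by (simp add: ell2_norm_def infsum_nonneg)
    \<comment> \<open>If \<open>ell2_norm f = 0\<close>, the quotient is \<open>0\<close> by the
      convention for division.\<close>
    ultimately have "\<rho> f \<le> opt_value n"
      using opt_value_pos[OF n] by (cases "ell2_norm f = 0") (auto simp: \<rho>_def divide_le_eq)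
    then show "ereal (\<rho> f) \<le> ereal (opt_value n)" by simp
  qed
  have "ereal (opt_value n) \<le> B \<and> (B = ereal (opt_value n) \<longleftrightarrow> (\<forall>k\<in>{- int n..int n}. u k = opt_kernel n k))"
    using lower upper opt by (auto intro: antisym)
  then show ?thesis
    by (simp only: B_def \<rho>_def opt_value_def node_angle_def)
qed

end
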